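(* Let $n$ be a positive integer and $k$ a nonnegative integer. Let $1\leq m_1<m_2<\cdots<m_r\leq n$ be integers, let $q_1,\ldots,q_r$ be positive integers, and let $M$ be the set consisting of $q_1$ different types of $m_1$, $q_2$ different types of $m_2$, ..., $q_r$ different types of $m_r$. For each integer $j\geq 1$ let $cc(j)$ denote the number of compositions of $j$ each of whose parts belongs to $M$, and set $cc(0)=1$. Let $ccw(n,k)$ denote the number of weak compositions of $n$ in which exactly $k$ parts are equal to zero and each nonzero part belongs to $M$. Then $$ccw(n,k)=\sum_{j_1+j_2+\cdots+j_{k+1}=n}cc(j_1)cc(j_2)\cdots cc(j_{k+1}),$$ where the sum is taken over all integers $j_t\geq 0$ $(t=1,2,\ldots,k+1)$ with $j_1+\cdots+j_{k+1}=n$.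
   Context: A composition of $j$ is an ordered sequence of positive parts whose sum is $j$; a weak composition is an ordered sequence of nonnegative parts with the given sum (parts equal to $0$ are allowed). Each nonzero part equal to $m_i$ comes in one of $q_i$ types, and (weak) compositions that differ in the types of their parts are counted as different; there is only one type of zero. *)

theory Defs
  imports Main
begin

text \<open>
  A typed part is a pair of its value and its type. The types of the value
  \<open>m i\<close> are numbered \<open>1, \<dots>, q i\<close>. The unique zero is the pair \<open>(0, 0)\<close>.
\<close>

type_synonym part = "nat \<times> nat"

definition typed_parts :: "nat \<Rightarrow> (nat \<Rightarrow> nat) \<Rightarrow> (nat \<Rightarrow> nat) \<Rightarrow> part set" where
  "typed_parts r m q = {(m i, t) | i t. i \<in> {1..r} \<and> t \<in> {1..q i}}"

definition zero_part :: part where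
  "zero_part = (0, 0)"

definition is_composition :: "nat \<Rightarrow> nat list \<Rightarrow> bool" where
  "is_composition j xs \<longleftrightarrow> (\<forall>x\<in>set xs. x > 0) \<and> sum_list xs = j"

definition is_weak_composition :: "nat \<Rightarrow> nat list \<Rightarrow> bool" where
  "is_weak_composition j xs \<longleftrightarrow> sum_list xs = j"

definition cc :: "part set \<Rightarrow> nat \<Rightarrow> nat" where
  "cc M j = (if j = 0 then 1
     else card {ps. is_composition j (map fst ps) \<and> set ps \<subseteq> M})"

definition ccw :: "part set \<Rightarrow> nat \<Rightarrow> nat \<Rightarrow> nat" where
  "ccw M n k = card {ps. is_weak_composition n (map fst ps)
     \<and> count_list (map fst ps) 0 = k
     \<and> (\<forall>p\<in>set ps. if fst p = 0 then p = zero_part else p \<in> M)}"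

end

(* A weak composition with k + 1 zeros splits uniquely at its first zero into a composition of
   some j and a weak composition of n - j with k zeros. The sum over (j_1, ..., j_(k+2)) obeys the
   same recurrence when j_1 is split off. *)

theory Submission
  imports Defs
begin

text \<open>Positivity of the parts is left to \<open>M\<close>, and 0 is an ordinary value of
  \<open>j\<close>: the empty list should account for the convention
  \<open>cc M 0 = 1\<close>.\<close>

definition comps :: "part set \<Rightarrow> nat \<Rightarrow> part list set" where
  "comps M j = {ps. sum_list (map fst ps) = j \<and> set ps \<subseteq> M}"

definition weak_comps :: "part set \<Rightarrow> nat \<Rightarrow> nat \<Rightarrow> part list set" where
  "weak_comps M n k = {ps. sum_list (map fst ps) = n \<and> count_list (map fst ps) 0 = k
     \<and> (\<forall>p\<in>set ps. if fst p = 0 then p = zero_part else p \<in> M)}"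

text \<open>For \<open>l = k + 1\<close> this is the index set of the sum to be reached; a free
  length permits induction.\<close>

definition seqs :: "nat \<Rightarrow> nat \<Rightarrow> nat list set" where
  "seqs l n = {js. length js = l \<and> sum_list js = n}"

lemma fst_zero_part [simp]: "fst zero_part = 0"
  by (simp add: zero_part_def)

lemma ccw_eq_card: "ccw M n k = card (weak_comps M n k)"
  by (simp add: ccw_def weak_comps_def is_weak_composition_def)

lemma length_le_sum_list:
  fixes xs :: "nat list"
  assumes "\<forall>x\<in>set xs. 0 < x"
  shows "length xs \<le> sum_list xs"
  using assms by (induction xs) auto

lemma seqs_Suc: "seqs (Suc l) n = (\<lambda>(j, js). j # js) ` (SIGMA j:{..n}. seqs l (n - j))"
proof (intro equalityI subsetI)
  fix js assume "js \<in> seqs (Suc l) n"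
  then obtain j js' where "js = j # js'" "length js' = l" "j + sum_list js' = n"
    by (auto simp: seqs_def length_Suc_conv)
  then show "js \<in> (\<lambda>(j, js). j # js) ` (SIGMA j:{..n}. seqs l (n - j))"
    by (intro image_eqI[where x = "(j, js')"]) (auto simp: seqs_def)
qed (auto simp: seqs_def)

lemma finite_seqs: "finite (seqs l n)"
proof (induction l arbitrary: n)
  case 0
  show ?case by (rule finite_subset[of _ "{[]}"]) (auto simp: seqs_def)
next
  case (Suc l)
  then show ?case by (simp add: seqs_Suc)
qed

text \<open>Consing is injective, so the sum can be reindexed over pairs of head and tail; the
  factor \<open>f j\<close> of the head then comes out of the inner sum.\<close>

lemma sum_seqs_Suc:
  fixes f :: "nat \<Rightarrow> nat"
  shows "(\<Sum>js\<in>seqs (Suc l) n. prod_list (map f js)) =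
    (\<Sum>j\<le>n. f j * (\<Sum>js\<in>seqs l (n - j). prod_list (map f js)))"
proof -
  have "inj_on (\<lambda>(j, js). j # js) (SIGMA j:{..n}. seqs l (n - j))"
    by (auto simp: inj_on_def)
  then have "(\<Sum>js\<in>seqs (Suc l) n. prod_list (map f js)) =
      (\<Sum>(j, js)\<in>(SIGMA j:{..n}. seqs l (n - j)). f j * prod_list (map f js))"
    unfolding seqs_Suc by (simp add: sum.reindex case_prod_unfold)
  also have "\<dots> = (\<Sum>j\<le>n. \<Sum>js\<in>seqs l (n - j). f j * prod_list (map f js))"
    by (subst sum.Sigma) (auto simp: finite_seqs)
  finally show ?thesis by (simp add: sum_distrib_left)
qed

lemma seqs_1: "seqs (Suc 0) n = {[n]}"
  by (auto simp: seqs_def length_Suc_conv)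

context
  fixes M :: "part set"
  assumes finite_M: "finite M" and pos: "\<And>p. p \<in> M \<Longrightarrow> 0 < fst p"
begin

lemma zero_notin: "(0, t) \<notin> M"
  using pos[of "(0, t)"] by auto

lemma fst_neq_0: "set ps \<subseteq> M \<Longrightarrow> p \<in> set ps \<Longrightarrow> fst p \<noteq> 0"
  using pos by (metis less_irrefl subsetD)

text \<open>Positive parts bound the length of a composition by its sum, and there are finitely many
  lists of bounded length over a finite alphabet.\<close>

lemma finite_comps: "finite (comps M j)"
proof (rule finite_subset)
  show "comps M j \<subseteq> {ps. set ps \<subseteq> M \<and> length ps \<le> j}"
  proof
    fix ps assume "ps \<in> comps M j"
    then have "set ps \<subseteq> M" "sum_list (map fst ps) = j" by (auto simp: comps_def)
    moreover have "length (map fst ps) \<le> sum_list (map fst ps)"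
      using \<open>set ps \<subseteq> M\<close> pos by (intro length_le_sum_list) auto
    ultimately show "ps \<in> {ps. set ps \<subseteq> M \<and> length ps \<le> j}" by simp
  qed
qed (rule finite_lists_length_le[OF finite_M])

lemma card_comps: "card (comps M j) = cc M j"
proof (cases "j = 0")
  case True
  have "comps M 0 = {[]}"
  proof (intro equalityI subsetI)
    fix ps assume ps: "ps \<in> comps M 0"
    then have "\<forall>p\<in>set ps. fst p = 0 \<and> p \<in> M" by (auto simp: comps_def)
    \<comment> \<open>The head of a nonempty list would be a member of \<open>M\<close> with value
      0.\<close>
    then show "ps \<in> {[]}" by (cases ps) (auto simp: zero_notin)
  qed (simp add: comps_def)
  with True show ?thesis by (simp add: cc_def)
next
  case False
  have "comps M j = {ps. is_composition j (map fst ps) \<and> set ps \<subseteq> M}"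
    using pos by (auto simp: comps_def is_composition_def)
  with False show ?thesis by (simp add: cc_def)
qed

lemma weak_comps_0: "weak_comps M n 0 = comps M n"
proof -
  have "0 \<notin> set (map fst ps)
      \<and> (\<forall>p\<in>set ps. if fst p = 0 then p = zero_part else p \<in> M) \<longleftrightarrow> set ps \<subseteq> M"
    (is "?l \<longleftrightarrow> ?r") for ps :: "part list"
  proof
    assume l: ?l
    show ?r
    proof
      fix p assume p: "p \<in> set ps"
      with l have "fst p \<noteq> 0" by (metis image_eqI set_map)
      with l p show "p \<in> M" by metis
    qed
  qed (auto dest: fst_neq_0)
  then show ?thesis
    by (simp only: weak_comps_def comps_def count_list_0_iff)
qed

text \<open>Cutting at the first zero leaves a prefix with all parts in \<open>M\<close>; the
  removed zero lowers the count by one and the sum by nothing. The entry \<open>j\<close> is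
  determined by \<open>ps\<close> and serves to index the union.\<close>

lemma weak_comps_Suc:
  "weak_comps M n (Suc k) = (\<lambda>(j, ps, qs). ps @ zero_part # qs) `
     (SIGMA j:{..n}. comps M j \<times> weak_comps M (n - j) k)" (is "_ = ?f ` ?S")
proof (intro equalityI subsetI)
  fix xs assume xs: "xs \<in> weak_comps M n (Suc k)"
  then have "0 \<in> set (map fst xs)"
    by (metis (mono_tags, lifting) count_notin mem_Collect_eq nat.distinct(1) weak_comps_def)
  \<comment> \<open>Zero has only one type, so a part of value 0 is \<open>zero_part\<close>
    itself.\<close>
  then have "zero_part \<in> set xs" using xs by (auto simp: weak_comps_def)
  then obtain ps qs where split: "xs = ps @ zero_part # qs" "zero_part \<notin> set ps"
    by (meson split_list_first)
  with xs have "set ps \<subseteq> M"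
    by (fastforce simp: weak_comps_def split: if_splits)
  then have "0 \<notin> set (map fst ps)" by (auto dest: fst_neq_0)
  then have "count_list (map fst ps) 0 = 0" by (rule count_notin)
  with xs split \<open>set ps \<subseteq> M\<close> have "(sum_list (map fst ps), ps, qs) \<in> ?S"
    by (auto simp: weak_comps_def comps_def)
  with split show "xs \<in> ?f ` ?S" by (intro image_eqI) auto
next
  fix xs assume "xs \<in> ?f ` ?S"
  then obtain j ps qs where *: "xs = ps @ zero_part # qs" "j \<le> n"
    "ps \<in> comps M j" "qs \<in> weak_comps M (n - j) k" by auto
  \<comment> \<open>Seen as a weak composition without zeros, the prefix brings its zero count and
    the validity of its parts in the form needed for the whole list.\<close>
  then have "ps \<in> weak_comps M j 0" by (simp add: weak_comps_0)
  with * show "xs \<in> weak_comps M n (Suc k)"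
    by (auto simp: weak_comps_def)
qed

text \<open>No part of the prefix is zero, so \<open>takeWhile\<close> stops exactly at the inserted
  zero and recovers \<open>ps\<close>; then \<open>j\<close> is its sum and \<open>qs\<close> is
  what follows.\<close>

lemma inj_on_join_at_zero:
  "inj_on (\<lambda>(j, ps, qs). ps @ zero_part # qs)
     (SIGMA j:{..n}. comps M j \<times> weak_comps M (n - j) k)"
proof -
  have split: "takeWhile (\<lambda>p. p \<noteq> zero_part) (xs @ zero_part # ys) = xs"
    if "xs \<in> comps M i" for xs ys i
    using that by (subst takeWhile_append2) (auto simp: comps_def dest: fst_neq_0)
  have unique: "j = j' \<and> ps = ps' \<and> qs = qs'"
    if eq: "ps @ zero_part # qs = ps' @ zero_part # qs'"
      and mem: "ps \<in> comps M j" "ps' \<in> comps M j'" for j ps qs j' ps' qs'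
  proof -
    have "ps = ps'" using split[OF mem(1), of qs] split[OF mem(2), of qs'] eq by simp
    with eq mem show ?thesis by (auto simp: comps_def)
  qed
  show ?thesis by (rule inj_onI) (auto dest: unique)
qed

lemma finite_weak_comps: "finite (weak_comps M n k)"
  by (induction k arbitrary: n) (auto simp: weak_comps_0 weak_comps_Suc finite_comps)

text \<open>Both sides satisfy the same recurrence in \<open>k\<close>. The sum \<open>n\<close>
  stays arbitrary because the induction hypothesis is used at every \<open>n - j\<close>.\<close>

lemma card_weak_comps:
  "card (weak_comps M n k) = (\<Sum>js\<in>seqs (Suc k) n. prod_list (map (cc M) js))"
proof (induction k arbitrary: n)
  case 0
  show ?case by (simp add: weak_comps_0 card_comps seqs_1)
next
  case (Suc k)
  have "card (weak_comps M n (Suc k)) =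
      (\<Sum>j\<le>n. card (comps M j \<times> weak_comps M (n - j) k))"
    unfolding weak_comps_Suc card_image[OF inj_on_join_at_zero]
    by (intro card_SigmaI) (auto simp: finite_comps finite_weak_comps)
  also have "\<dots> = (\<Sum>j\<le>n. cc M j * (\<Sum>js\<in>seqs (Suc k) (n - j). prod_list (map (cc M) js)))"
    by (simp add: card_cartesian_product card_comps Suc.IH)
  finally show ?case by (simp only: sum_seqs_Suc)
qed

end

lemma finite_typed_parts: "finite (typed_parts r m q)"
proof -
  have "typed_parts r m q = (\<lambda>(i, t). (m i, t)) ` (SIGMA i:{1..r}. {1..q i})"
    by (auto simp: typed_parts_def)
  then show ?thesis by simp
qed

theorem theorem8:
  fixes n k r :: nat and m q :: "nat \<Rightarrow> nat" and M :: "part set"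
  assumes "n \<ge> 1"
    and "r \<ge> 1"
    and "\<And>i. i \<in> {1..r} \<Longrightarrow> 1 \<le> m i \<and> m i \<le> n"
    and "strict_mono_on {1..r} m"
    and "\<And>i. i \<in> {1..r} \<Longrightarrow> q i \<ge> 1"
    and "M = typed_parts r m q"
  shows "ccw M n k =
    (\<Sum>js\<in>{js :: nat list. length js = k + 1 \<and> sum_list js = n}. prod_list (map (cc M) js))"
proof -
  have "finite M" using assms(6) by (simp add: finite_typed_parts)
  moreover have "0 < fst p" if "p \<in> M" for p
    \<comment> \<open>The bound \<open>1 \<le> m i\<close> keeps the members of \<open>M\<close>
      distinct from zero.\<close>
    using that assms(3,6) by (auto simp: typed_parts_def Suc_le_eq)
  ultimately show ?thesis
    by (simp add: ccw_eq_card card_weak_comps seqs_def)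
qed

end
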